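(* Let $h\geq 0$ be an integer. If $h$ is odd, the matrix $\mathsf{B}_h^{(1)}$ has full row rank and $Q_h^{(1)}M=0$. If $h$ is even, the classes in $Q_h^{(1)}M$ represented by the elements of $G_h$ form a basis of $Q_h^{(1)}M$. In particular, $$\dim_{\mathbb F_2} Q_h^{(1)}M=\begin{cases}0,& h\text{ odd},\\ \left\lfloor\dfrac{h+2}{8}\right\rfloor+1,& h\text{ even}.\end{cases}$$ Moreover, for every $h\ge 0$ the matrix $\mathsf{B}_h^{(1)}$ has a minor of size $\dim M_h-\dim Q_h^{(1)}M$ and determinant $1$ (over $\mathbb F_2$).
   Context: Let $M=\widetilde H^*(MO(2);\mathbb F_2)$ be the reduced mod $2$ cohomology of the Thom space $MO(2)$ of the universal real two-plane bundle. Write $S=H^*(BO(2);\mathbb F_2)=\mathbb F_2[w_1,w_2]$ with $|w_1|=1$, $|w_2|=2$ (Stiefel--Whitney classes; by the splitting principle $S=\mathbb F_2[x,y]^{\mathfrak S_2}$ with $w_1=x+y$, $w_2=xy$, $|x|=|y|=1$). Then $M=uS$ is free over $S$ on the Thom class $u$ of degree $2$, and the Steenrod squares act on $M$ by the Cartan formula, the usual action on $S$, and the Thom identity $\mathrm{Sq}(u)=u(1+w_1+w_2)$ for the total square $\mathrm{Sq}=\sum_k \mathrm{Sq}^k$. For $n,m\ge 0$ let $v_{n,m}=u\,w_1^n w_2^m$. Its internal degree is $n+2m$ (its cohomological degree is $n+2m+2$). For $h\ge 0$ let $M_h=\mathrm{span}_{\mathbb F_2}\{v_{n,m}: n+2m=h\}$,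 and $M_d=0$ for $d<0$. The ordered basis of $M_h$ is $e_m^{(h)}=v_{h-2m,m}$, $0\le m\le\lfloor h/2\rfloor$. Let $\mathcal A(1)$ be the subalgebra of the mod $2$ Steenrod algebra generated by $\mathrm{Sq}^1,\mathrm{Sq}^2$, with augmentation ideal $\mathcal A(1)^+$ (its elements of positive degree). Put $Q_h^{(1)}M=M_h/(\mathcal A(1)^+M)_h$, where the subscript $h$ denotes the component of internal degree $h$. $\mathsf{B}_h^{(1)}$ is the matrix over $\mathbb F_2$ with rows indexed by the basis vectors $e_m^{(h)}$ of $M_h$ and columns the coordinate vectors of all $\mathrm{Sq}^1(e_m^{(h-1)})$ and all $\mathrm{Sq}^2(e_m^{(h-2)})$ for which the source basis vector exists (i.e. $0\le m\le\lfloor (h-1)/2\rfloor$, respectively $0\le m\le \lfloor (h-2)/2\rfloor$). A minor means the determinant of a square submatrix given by a choice of rows and columns; the determinant of a $0\times0$ matrix is $1$. For even $h\ge 0$ the set $G_h$ is defined as follows. If $h\equiv 0\pmod 4$, $$G_h=\{e_{2+4a}^{(h)}: a\ge 0,\ 2+4a\le h/2\}\cup\begin{cases}\{e_{h/2}^{(h)}\},& h\equiv 0\pmod 8,\\ \emptyset,& h\equiv 4\pmod 8.\end{cases}$$ If $h\equiv 2\pmod 4$, $$G_h=\{e_{4a}^{(h)}: a\ge 0,\ 4a\le h/2\}\cup\begin{cases}\{e_{h/2}^{(h)}\},& h\equiv 6\pmod 8,\\ \emptyset,& h\equiv 2\pmod 8.\end{cases}$$ *)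

theory Defs
  imports
    "HOL-Library.Z2"
    "HOL-Algebra.AbelCoset"
    "Jordan_Normal_Form.Char_Poly"
    "Jordan_Normal_Form.DL_Rank_Submatrix"
begin

text \<open>These rules would rewrite the field operations of \<open>F_2\<close> to bit operations.\<close>
declare add_bit_eq_xor [simp del] mult_bit_eq_and [simp del]


section \<open>Quotient modules\<close>

text \<open>The cosets form the additive factor group \<open>V A_Mod N\<close>; a scalar acts through
  representatives, in the same style as the product of cosets in \<open>FactRing\<close>.\<close>

definition quotient_module ::
    "('a, 'b, 'm) module_scheme \<Rightarrow> 'b set \<Rightarrow> ('a, 'b set) module" where
  "quotient_module V N =
     \<lparr>carrier = a_rcosets\<^bsub>V\<^esub> N, monoid.mult = undefined, one = undefined, zero = N,
      add = set_add V, smult = (\<lambda>c X. \<Union>x\<in>X. N +>\<^bsub>V\<^esub> (c \<odot>\<^bsub>V\<^esub> x))\<rparr>"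

lemma submodule_abelian_subgroup:
  fixes R and V (structure)
  assumes "submodule R N V"
  shows "abelian_subgroup N V"
proof -
  interpret submodule R N V by fact
  interpret module R V by (rule module)
  have "subgroup N (add_monoid V)"
  proof (rule M.add.subgroupI)
    show "N \<noteq> {}" using submodule.zero_closed[OF assms] by blast
    fix a assume a: "a \<in> N"
    then have "a \<in> carrier V" using subset by auto
    then have "\<ominus>\<^bsub>V\<^esub> a = (\<ominus>\<^bsub>R\<^esub> \<one>\<^bsub>R\<^esub>) \<odot>\<^bsub>V\<^esub> a" by (simp add: smult_l_minus)
    then show "\<ominus>\<^bsub>V\<^esub> a \<in> N" using smult_closed a by simp
  qed (use subset in \<open>auto\<close>)
  then show ?thesis
    by (intro abelian_subgroupI3 additive_subgroup.intro) (use M.abelian_group_axioms in simp_all)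
qed

lemma quotient_module_smult:
  fixes R and V (structure)
  assumes N: "submodule R N V" and c: "c \<in> carrier R" and x: "x \<in> carrier V"
  shows "c \<odot>\<^bsub>quotient_module V N\<^esub> (N +>\<^bsub>V\<^esub> x) = N +>\<^bsub>V\<^esub> (c \<odot>\<^bsub>V\<^esub> x)"
proof -
  interpret submodule R N V by fact
  interpret module R V by (rule module)
  interpret abelian_subgroup N V using N by (rule submodule_abelian_subgroup)
  have "N +>\<^bsub>V\<^esub> (c \<odot>\<^bsub>V\<^esub> y) = N +>\<^bsub>V\<^esub> (c \<odot>\<^bsub>V\<^esub> x)" if y: "y \<in> N +>\<^bsub>V\<^esub> x" for y
  proof -
    obtain n where n: "n \<in> N" "y = n \<oplus>\<^bsub>V\<^esub> x" using y unfolding a_r_coset_def' by blast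
    have "c \<odot>\<^bsub>V\<^esub> y = c \<odot>\<^bsub>V\<^esub> n \<oplus>\<^bsub>V\<^esub> c \<odot>\<^bsub>V\<^esub> x"
      using n x c subset by (simp add: smult_r_distr subset_iff)
    moreover have "c \<odot>\<^bsub>V\<^esub> n \<in> N" using n c by simp
    ultimately have "c \<odot>\<^bsub>V\<^esub> y \<in> N +>\<^bsub>V\<^esub> (c \<odot>\<^bsub>V\<^esub> x)"
      unfolding a_r_coset_def' by blast
    moreover have "c \<odot>\<^bsub>V\<^esub> x \<in> carrier V" using c x by simp
    ultimately show ?thesis using a_repr_independence' by simp
  qed
  moreover have "x \<in> N +>\<^bsub>V\<^esub> x" using x by (rule a_rcos_self)
  ultimately have "(\<Union>y\<in>N +>\<^bsub>V\<^esub> x. N +>\<^bsub>V\<^esub> (c \<odot>\<^bsub>V\<^esub> y)) = N +>\<^bsub>V\<^esub> (c \<odot>\<^bsub>V\<^esub> x)"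
    by blast
  then show ?thesis by (simp add: quotient_module_def)
qed

lemma quotient_module_module:
  fixes R and V (structure)
  assumes N: "submodule R N V"
  shows "module R (quotient_module V N)"
proof -
  interpret submodule R N V by fact
  interpret module R V by (rule module)
  interpret abelian_subgroup N V using N by (rule submodule_abelian_subgroup)
  let ?Q = "quotient_module V N"
  have car: "\<exists>x\<in>carrier V. X = N +>\<^bsub>V\<^esub> x" if "X \<in> carrier ?Q" for X
    using that by (auto simp: quotient_module_def A_RCOSETS_def')
  have inc: "N +>\<^bsub>V\<^esub> x \<in> carrier ?Q" if "x \<in> carrier V" for x
    using that by (auto simp: quotient_module_def A_RCOSETS_def')
  have add: "(N +>\<^bsub>V\<^esub> x) \<oplus>\<^bsub>?Q\<^esub> (N +>\<^bsub>V\<^esub> y) = N +>\<^bsub>V\<^esub> (x \<oplus>\<^bsub>V\<^esub> y)"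
    if "x \<in> carrier V" "y \<in> carrier V" for x y
    using that a_rcos_sum by (simp add: quotient_module_def)
  have zero: "\<zero>\<^bsub>?Q\<^esub> = N +>\<^bsub>V\<^esub> \<zero>\<^bsub>V\<^esub>"
    using a_coset_add_zero[OF subset] by (simp add: quotient_module_def)
  have ag: "abelian_group ?Q"
  proof (rule abelian_groupI)
    fix X Y assume "X \<in> carrier ?Q" "Y \<in> carrier ?Q"
    then obtain x y where xy: "x \<in> carrier V" "X = N +>\<^bsub>V\<^esub> x" "y \<in> carrier V" "Y = N +>\<^bsub>V\<^esub> y"
      using car by metis
    then show "X \<oplus>\<^bsub>?Q\<^esub> Y \<in> carrier ?Q" "X \<oplus>\<^bsub>?Q\<^esub> Y = Y \<oplus>\<^bsub>?Q\<^esub> X"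
      by (simp_all add: add inc M.a_comm)
    fix Z assume "Z \<in> carrier ?Q"
    then obtain z where "z \<in> carrier V" "Z = N +>\<^bsub>V\<^esub> z"
      using car by metis
    with xy show "X \<oplus>\<^bsub>?Q\<^esub> Y \<oplus>\<^bsub>?Q\<^esub> Z = X \<oplus>\<^bsub>?Q\<^esub> (Y \<oplus>\<^bsub>?Q\<^esub> Z)"
      by (simp add: add M.a_assoc)
  next
    show "\<zero>\<^bsub>?Q\<^esub> \<in> carrier ?Q" by (simp add: zero inc)
  next
    fix X assume "X \<in> carrier ?Q"
    then obtain x where x: "x \<in> carrier V" "X = N +>\<^bsub>V\<^esub> x"
      using car by metis
    then show "\<zero>\<^bsub>?Q\<^esub> \<oplus>\<^bsub>?Q\<^esub> X = X" by (simp add: zero add)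
    from x show "\<exists>Y\<in>carrier ?Q. Y \<oplus>\<^bsub>?Q\<^esub> X = \<zero>\<^bsub>?Q\<^esub>"
      by (intro bexI[of _ "N +>\<^bsub>V\<^esub> (\<ominus>\<^bsub>V\<^esub> x)"]) (simp_all add: add inc zero M.l_neg)
  qed
  note sm = quotient_module_smult[OF N]
  show ?thesis
  proof (rule moduleI[OF _ ag])
    show "cring R" ..
  next
    fix a X assume "a \<in> carrier R" "X \<in> carrier ?Q"
    then show "a \<odot>\<^bsub>?Q\<^esub> X \<in> carrier ?Q" by (auto dest!: car simp: sm inc)
  next
    fix a b X assume "a \<in> carrier R" "b \<in> carrier R" "X \<in> carrier ?Q"
    then show "(a \<oplus>\<^bsub>R\<^esub> b) \<odot>\<^bsub>?Q\<^esub> X = a \<odot>\<^bsub>?Q\<^esub> X \<oplus>\<^bsub>?Q\<^esub> b \<odot>\<^bsub>?Q\<^esub> X"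
      by (auto dest!: car simp: sm add smult_l_distr)
  next
    fix a X Y assume "a \<in> carrier R" "X \<in> carrier ?Q" "Y \<in> carrier ?Q"
    then show "a \<odot>\<^bsub>?Q\<^esub> (X \<oplus>\<^bsub>?Q\<^esub> Y) = a \<odot>\<^bsub>?Q\<^esub> X \<oplus>\<^bsub>?Q\<^esub> a \<odot>\<^bsub>?Q\<^esub> Y"
      by (auto dest!: car simp: sm add smult_r_distr)
  next
    fix a b X assume "a \<in> carrier R" "b \<in> carrier R" "X \<in> carrier ?Q"
    then show "(a \<otimes>\<^bsub>R\<^esub> b) \<odot>\<^bsub>?Q\<^esub> X = a \<odot>\<^bsub>?Q\<^esub> (b \<odot>\<^bsub>?Q\<^esub> X)"
      by (auto dest!: car simp: sm smult_assoc1)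
  next
    fix X assume "X \<in> carrier ?Q"
    then show "\<one>\<^bsub>R\<^esub> \<odot>\<^bsub>?Q\<^esub> X = X" by (auto dest!: car simp: sm)
  qed
qed


section \<open>Cohomology of \<open>BO(2)\<close> and of the Thom space \<open>MO(2)\<close>\<close>

text \<open>\<open>S = F_2[w1][w2]\<close>: the outer polynomial variable is \<open>w2\<close>, so the coefficient of
  \<open>w1 ^ n * w2 ^ m\<close> in \<open>s\<close> is \<open>coeff (coeff s m) n\<close>.\<close>

type_synonym S = "bit poly poly"

definition w1 :: S where "w1 = [:[:0, 1:]:]"
definition w2 :: S where "w2 = [:0, 1:]"

text \<open>The Steenrod squares are collected in \<open>Sq_S s = (\<Sum>k. Sq^k(s) t^k)\<close>, an element of \<open>S[t]\<close>.
  The Cartan formula says that \<open>Sq_S\<close> is a ring homomorphism, so it is the substitution determined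
  by the Wu formulas \<open>Sq w1 = w1 + w1^2\<close> and \<open>Sq w2 = w2 + w1 w2 + w2^2\<close>; the lemma
  \<open>Sq_splitting\<close> below derives it from the splitting principle.\<close>

definition Sq_S :: "S \<Rightarrow> S poly" where
  "Sq_S s = eval_poly (\<lambda>p. eval_poly (\<lambda>c. [:[:[:c:]:]:]) p [:w1, w1 ^ 2:]) s [:w2, w1 * w2, w2 ^ 2:]"

text \<open>\<open>M = u S\<close> is free of rank one on the Thom class; the element \<open>u s\<close> of \<open>M\<close> is represented by
  \<open>s\<close>. The factor \<open>[:1, w1, w2:]\<close> is the Thom identity \<open>Sq u = u (1 + w1 + w2)\<close>.\<close>

definition Sq_M :: "nat \<Rightarrow> S \<Rightarrow> S" where
  "Sq_M k s = coeff ([:1, w1, w2:] * Sq_S s) k"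

definition vMO :: "nat \<Rightarrow> nat \<Rightarrow> S" where "vMO n m = w1 ^ n * w2 ^ m"

definition MO2 :: "(bit, S) module" where
  "MO2 = \<lparr>carrier = UNIV, monoid.mult = undefined, one = undefined, zero = 0, add = (+),
        smult = (\<lambda>c s. Polynomial.smult [:c:] s)\<rparr>"

definition MO2_deg :: "nat \<Rightarrow> (bit, S) module" where
  "MO2_deg h = MO2\<lparr>carrier := LinearCombinations.module.span class_ring MO2 {vMO n m | n m. n + 2 * m = h}\<rparr>"

text \<open>\<open>eMO h m\<close> is meaningful only for \<open>m \<le> h div 2\<close>.\<close>

definition eMO :: "nat \<Rightarrow> nat \<Rightarrow> S" where "eMO h m = vMO (h - 2 * m) m"


section \<open>The module of \<open>\<A>(1)\<close>-indecomposables\<close>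

text \<open>\<open>A1 d \<theta>\<close>: the operator \<open>\<theta>\<close> on \<open>M\<close> is the action of an element of degree \<open>d\<close> of \<open>\<A>(1)\<close>, the
  subalgebra of the Steenrod algebra generated by \<open>Sq^1\<close> and \<open>Sq^2\<close>. Only this action enters
  \<open>\<A>(1)\<^sup>+ M\<close>. The scalars of \<open>F_2\<close> are covered by the zero operator.\<close>

inductive A1 :: "nat \<Rightarrow> (S \<Rightarrow> S) \<Rightarrow> bool" where
  A1_one: "A1 0 (\<lambda>s. s)"
| A1_Sq1: "A1 1 (Sq_M 1)"
| A1_Sq2: "A1 2 (Sq_M 2)"
| A1_zero: "A1 d (\<lambda>s. 0)"
| A1_add: "A1 d \<theta> \<Longrightarrow> A1 d \<phi> \<Longrightarrow> A1 d (\<lambda>s. \<theta> s + \<phi> s)"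
| A1_mult: "A1 c \<theta> \<Longrightarrow> A1 d \<phi> \<Longrightarrow> A1 (c + d) (\<theta> \<circ> \<phi>)"

definition A1_plus_M :: "S set" where
  "A1_plus_M = LinearCombinations.module.span class_ring MO2 {\<theta> s | d \<theta> s. d > 0 \<and> A1 d \<theta>}"

text \<open>\<open>A1_plus_M\<close> is a graded subspace, so its component of internal degree \<open>h\<close> is its intersection
  with \<open>M_h\<close>.\<close>

definition Qmod :: "nat \<Rightarrow> (bit, S set) module" where
  "Qmod h = quotient_module (MO2_deg h) (A1_plus_M \<inter> carrier (MO2_deg h))"

definition Q_class :: "nat \<Rightarrow> S \<Rightarrow> S set" where
  "Q_class h s = (A1_plus_M \<inter> carrier (MO2_deg h)) +>\<^bsub>MO2_deg h\<^esub> s"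


section \<open>The matrix \<open>B_h\<close> and the sets \<open>G_h\<close>\<close>

text \<open>The coordinates, for \<open>s\<close> in \<open>M_h\<close>, with respect to the basis \<open>eMO h 0, ..., eMO h (h div 2)\<close>.\<close>

definition coords :: "nat \<Rightarrow> S \<Rightarrow> bit vec" where
  "coords h s = vec (h div 2 + 1) (\<lambda>m. coeff (coeff s m) (h - 2 * m))"

text \<open>The guards are needed because subtraction on \<open>nat\<close> truncates.\<close>

definition Bmat :: "nat \<Rightarrow> bit mat" where
  "Bmat h = mat_of_cols (h div 2 + 1) (map (coords h)
     ((if h \<ge> 1 then map (\<lambda>m. Sq_M 1 (eMO (h - 1) m)) [0..<(h - 1) div 2 + 1] else []) @
      (if h \<ge> 2 then map (\<lambda>m. Sq_M 2 (eMO (h - 2) m)) [0..<(h - 2) div 2 + 1] else [])))"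

definition Gset :: "nat \<Rightarrow> S set" where
  "Gset h =
    (if h mod 4 = 0
     then {eMO h (2 + 4 * a) | a. 2 + 4 * a \<le> h div 2} \<union> (if h mod 8 = 0 then {eMO h (h div 2)} else {})
     else {eMO h (4 * a) | a. 4 * a \<le> h div 2} \<union> (if h mod 8 = 6 then {eMO h (h div 2)} else {}))"


section \<open>Consistency of the definitions\<close>

lemma eval_poly_comm_ring_hom:
  assumes "comm_ring_hom f"
  shows "comm_ring_hom (\<lambda>p. eval_poly f p x)"
proof -
  interpret comm_ring_hom f by fact
  interpret f: map_poly_comm_ring_hom f ..
  show ?thesis
    by unfold_locales (simp_all add: eval_poly_def hom_distribs)
qed

lemma comm_ring_hom_const2: "comm_ring_hom (\<lambda>c :: bit. [:[:c:]:])"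
  by unfold_locales (simp_all add: one_pCons)

lemma comm_ring_hom_const3: "comm_ring_hom (\<lambda>c :: bit. [:[:[:c:]:]:])"
  by unfold_locales (simp_all add: one_pCons)

lemma Sq_S_hom: "comm_ring_hom Sq_S"
  unfolding Sq_S_def[abs_def]
  by (intro eval_poly_comm_ring_hom comm_ring_hom_const3)

interpretation Sq_S: comm_ring_hom Sq_S by (rule Sq_S_hom)

lemma eval_poly_pCons0: "f 0 = 0 \<Longrightarrow> eval_poly f (pCons a p) x = f a + x * eval_poly f p x"
  by (cases "a = 0 \<and> p = 0") (auto simp: eval_poly_def map_poly_pCons)

lemma Sq_S_w: "Sq_S w1 = [:w1, w1 ^ 2:]" "Sq_S w2 = [:w2, w1 * w2, w2 ^ 2:]"
  by (simp_all add: Sq_S_def w1_def w2_def eval_poly_pCons0 one_pCons[symmetric] eval_poly_def)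

lemma Sq_M_Cartan: "Sq_M k (r * s) = (\<Sum>i\<le>k. Sq_M i r * coeff (Sq_S s) (k - i))"
  unfolding Sq_M_def Sq_S.hom_mult mult.assoc[symmetric]
  by (rule coeff_mult)

text \<open>The splitting principle: under \<open>w1 \<mapsto> x + y\<close>, \<open>w2 \<mapsto> x y\<close> the squares on \<open>S\<close> are those of
  \<open>F_2[x, y]\<close> with \<open>Sq x = x + x^2\<close> and \<open>Sq y = y + y^2\<close>, where \<open>x\<close> and \<open>y\<close> are the inner and the
  outer variable.\<close>

lemma Sq_splitting:
  fixes x y :: "bit poly poly"
  defines "x \<equiv> [:[:0, 1:]:]" and "y \<equiv> [:0, 1:]"
  defines "Sq_P \<equiv> \<lambda>p. eval_poly (\<lambda>q. eval_poly (\<lambda>c. [:[:[:c:]:]:]) q [:x, x ^ 2:]) p [:y, y ^ 2:]"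
  defines "\<phi> \<equiv> \<lambda>s :: S. eval_poly (\<lambda>q. eval_poly (\<lambda>c. [:[:c:]:]) q (x + y)) s (x * y)"
  shows "\<phi> (coeff (Sq_S s) k) = coeff (Sq_P (\<phi> s)) k"
proof -
  interpret P: comm_ring_hom Sq_P
    unfolding Sq_P_def by (intro eval_poly_comm_ring_hom comm_ring_hom_const3)
  interpret phi: comm_ring_hom \<phi>
    unfolding \<phi>_def by (intro eval_poly_comm_ring_hom comm_ring_hom_const2)
  interpret mp: map_poly_comm_ring_hom \<phi> ..
  define L where "L = (\<lambda>s. map_poly \<phi> (Sq_S s))"
  define R where "R = (\<lambda>s. Sq_P (\<phi> s))"
  interpret L: comm_ring_hom L
    unfolding L_def by unfold_locales (simp_all add: Sq_S.hom_add Sq_S.hom_mult mp.hom_add mp.hom_mult)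
  interpret R: comm_ring_hom R
    unfolding R_def by unfold_locales (simp_all add: P.hom_add P.hom_mult phi.hom_add phi.hom_mult)
  have bit2: "b + b = 0" for b :: bit by (cases b) simp_all
  have two: "a + a = 0" for a :: "bit poly poly"
    by (intro poly_eqI) (simp only: coeff_add bit2 coeff_0)
  have phi_w: "\<phi> w1 = x + y" "\<phi> w2 = x * y"
    by (simp_all add: \<phi>_def w1_def w2_def eval_poly_pCons0 one_pCons[symmetric] eval_poly_def)
  have P_xy: "Sq_P x = [:x, x ^ 2:]" "Sq_P y = [:y, y ^ 2:]"
    by (simp_all add: Sq_P_def x_def y_def eval_poly_pCons0 one_pCons[symmetric] eval_poly_def)
  have sq: "(x + y) ^ 2 = x ^ 2 + y ^ 2"
    unfolding power2_sum using two[of "x * y"] by (simp add: mult_2 algebra_simps)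
  have mp2: "map_poly \<phi> [:a, b:] = [:\<phi> a, \<phi> b:]"
    and mp3: "map_poly \<phi> [:a, b, d:] = [:\<phi> a, \<phi> b, \<phi> d:]" for a b d
    by (intro poly_eqI; simp add: coeff_pCons split: nat.splits)+
  have gen1: "L w1 = R w1"
    by (simp add: L_def R_def Sq_S_w phi_w P_xy P.hom_add phi.hom_power mp2 sq)
  have gen2: "L w2 = R w2"
    by (simp add: L_def R_def Sq_S_w phi_w P_xy P.hom_mult phi.hom_mult phi.hom_power mp3)
      (simp add: power2_eq_square algebra_simps)
  have c: "L [:[:c:]:] = R [:[:c:]:]" for c
    by (cases c) (simp_all add: one_pCons[symmetric])
  have in1: "L [:q:] = R [:q:]" for q
  proof (induction q)
    case (pCons a q)
    have "[:pCons a q:] = [:[:a:]:] + w1 * [:q:]" by (simp add: w1_def)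
    then show ?case by (simp only: L.hom_add L.hom_mult R.hom_add R.hom_mult c gen1 pCons.IH)
  qed simp
  have "L s = R s"
  proof (induction s)
    case (pCons a s)
    have "pCons a s = [:a:] + w2 * s" by (simp add: w2_def)
    then show ?case by (simp only: L.hom_add L.hom_mult R.hom_add R.hom_mult in1 gen2 pCons.IH)
  qed simp
  then have "coeff (L s) k = coeff (R s) k" by simp
  then show ?thesis by (simp add: L_def R_def)
qed

lemma coords_eMO:
  assumes "m \<le> h div 2"
  shows "coords h (eMO h m) = unit_vec (h div 2 + 1) m"
proof -
  have w1: "w1 ^ n = [:Polynomial.monom 1 n:]" for n
    by (induction n) (simp_all add: w1_def one_pCons monom_Suc monom_0)
  have w2: "w2 ^ n = Polynomial.monom 1 n" for n
    by (induction n) (simp_all add: w2_def monom_Suc monom_0)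
  show ?thesis
    by (rule eq_vecI) (use assms in \<open>auto simp: coords_def eMO_def vMO_def w1 w2 coeff_monom\<close>)
qed

lemma MO2_vectorspace: "vectorspace (class_ring :: bit ring) MO2"
proof -
  have ag: "abelian_group MO2"
  proof (rule abelian_groupI)
    fix s assume "s \<in> carrier MO2"
    show "\<exists>t\<in>carrier MO2. t \<oplus>\<^bsub>MO2\<^esub> s = \<zero>\<^bsub>MO2\<^esub>"
      by (rule bexI[of _ "- s"]) (simp_all add: MO2_def)
  qed (simp_all add: MO2_def ac_simps)
  have F: "field (class_ring :: bit ring)"
    by (rule class_field)
  then have cr: "cring (class_ring :: bit ring)"
    by (simp add: field_def domain_def)
  have "Module.module (class_ring :: bit ring) MO2"
    by (rule moduleI[OF cr ag]) (simp_all add: MO2_def smult_add_left[symmetric] smult_add_right one_pCons[symmetric] mult.commute)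
  then show ?thesis using F by (simp add: vectorspace_def)
qed

lemma Qmod_vectorspace: "vectorspace class_ring (Qmod h)"
proof -
  interpret M: vectorspace "class_ring :: bit ring" MO2 by (rule MO2_vectorspace)
  have deg: "submodule class_ring (carrier (MO2_deg h)) MO2"
    unfolding MO2_deg_def
    by (simp, rule M.span_is_submodule) (simp add: MO2_def)
  have A1: "submodule class_ring A1_plus_M MO2"
    unfolding A1_plus_M_def by (rule M.span_is_submodule) (simp add: MO2_def)
  have eq: "MO2_deg h = MO2\<lparr>carrier := carrier (MO2_deg h)\<rparr>"
    by (simp add: MO2_deg_def)
  have "Module.module class_ring (MO2_deg h)"
    by (subst eq) (rule M.submodule_is_module[OF deg])
  then have "submodule class_ring (A1_plus_M \<inter> carrier (MO2_deg h)) (MO2_deg h)"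
    using A1 deg unfolding submodule_def by (auto simp: MO2_deg_def)
  then have "Module.module class_ring (Qmod h)"
    unfolding Qmod_def by (rule quotient_module_module)
  then show ?thesis using class_field by (simp add: vectorspace_def)
qed

end

theory Submission
  imports Defs
begin

text \<open>The relations in internal degree \<open>h\<close> are \<open>Sq^1 e_m = (h - m) e_m\<close> and
  \<open>Sq^2 e_m = binomial (h - 1 - m) 2 e_m + (m + 1) e_(m + 1)\<close>, where on the left \<open>e_m\<close> has degree \<open>h - 1\<close> and
  \<open>h - 2\<close>. So, apart from one identification \<open>e_(h/2 - 1) = e_(h/2)\<close> for \<open>h mod 8 = 6\<close>, each basis vector either
  survives or is killed, depending on residues mod 4 and mod 8. The survivors span modulo the relations, and
  explicit functionals vanishing on the images of \<open>Sq^1\<close> and \<open>Sq^2\<close> separate them. For the minor, delete the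
  rows of the survivors and choose one column per remaining row: a row functional supported on these rows that
  vanishes on these columns is zero, so the square submatrix is invertible, and over \<open>F_2\<close> its determinant is 1.\<close>

section \<open>Steenrod squares on monomials\<close>

lemma bit_poly_add_self: "s + s = (0 :: S)"
proof -
  have "b + b = 0" for b :: bit by (cases b) simp_all
  then show ?thesis by (intro poly_eqI) (simp only: coeff_add coeff_0)
qed

lemma of_nat_S: "(of_nat k :: S) = of_bool (odd k)"
  by (induction k) (auto simp: bit_poly_add_self)

lemma coeff_vMO: "coeff (coeff (vMO n m) j) i = (if j = m \<and> i = n then 1 else 0)"
proof -
  have "w1 ^ n = [:Polynomial.monom 1 n:]"
    by (induction n) (simp_all add: w1_def one_pCons monom_Suc monom_0)
  moreover have "w2 ^ m = Polynomial.monom 1 m"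
    by (induction m) (simp_all add: w2_def monom_Suc monom_0)
  ultimately show ?thesis
    by (auto simp: vMO_def coeff_monom)
qed

text \<open>Over F_2 every element of \<open>S\<close> is a sum of monomials without coefficients,
  so no scalar case arises. The inner induction strips powers of \<open>w1\<close>, the outer one
  powers of \<open>w2\<close>; the arbitrary monomial factor absorbs each stripped variable.\<close>

lemma S_monomial_induct [case_names zero add vMO]:
  assumes "P 0" and "\<And>s t. P s \<Longrightarrow> P t \<Longrightarrow> P (s + t)" and "\<And>n m. P (vMO n m)"
  shows "P (s :: S)"
proof -
  have const: "P ([:q:] * vMO n m)" for q :: "bit poly" and n m
  proof (induction q arbitrary: n)
    case (pCons a q)
    have "[:pCons a q:] = [:[:a:]:] + w1 * [:q:]" by (simp add: w1_def)
    then have "[:pCons a q:] * vMO n m = [:[:a:]:] * vMO n m + [:q:] * vMO (Suc n) m"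
      by (simp add: vMO_def algebra_simps)
    moreover have "P ([:[:a:]:] * vMO n m)"
      using assms by (cases a) (simp_all add: one_pCons[symmetric])
    ultimately show ?case using assms(2) pCons.IH by simp
  qed (simp add: assms)
  have "P (s * vMO 0 m)" for m
  proof (induction s arbitrary: m)
    case (pCons a s)
    have "pCons a s = [:a:] + w2 * s" by (simp add: w2_def)
    then have "pCons a s * vMO 0 m = [:a:] * vMO 0 m + s * vMO 0 (Suc m)"
      by (simp add: vMO_def algebra_simps)
    then show ?case using assms(2) const pCons.IH by simp
  qed (simp add: assms)
  from this[of 0] show ?thesis by (simp add: vMO_def)
qed

text \<open>All factors agree with \<open>1 + a t\<close> up to first order, so modulo t^3 the
  product is \<open>(1 + a t) ^ (n + m)\<close> plus one term \<open>b t^2\<close> from each of the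
  \<open>m\<close> quadratic factors.\<close>

lemma coeff_truncated_powers:
  fixes a b :: "'a :: comm_ring_1"
  defines "p \<equiv> \<lambda>n m. [:1, a:] ^ n * [:1, a, b:] ^ m"
  shows "coeff (p n m) 0 = 1" and "coeff (p n m) 1 = of_nat (n + m) * a"
    and "coeff (p n m) 2 = of_nat ((n + m) choose 2) * a ^ 2 + of_nat m * b"
proof -
  have "coeff (p n m) 0 = 1 \<and> coeff (p n m) 1 = of_nat (n + m) * a \<and>
    coeff (p n m) 2 = of_nat ((n + m) choose 2) * a ^ 2 + of_nat m * b"
  proof (induction n)
    case 0
    show ?case
    proof (induction m)
      case (Suc m)
      have "p 0 (Suc m) = [:1, a, b:] * p 0 m" by (simp add: p_def)
      with Suc show ?case
        by (simp add: numeral_2_eq_2 algebra_simps)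
    qed (simp add: p_def numeral_2_eq_2)
  next
    case (Suc n)
    have "p (Suc n) m = [:1, a:] * p n m" by (simp only: p_def power_Suc mult.assoc)
    with Suc show ?case
      by (simp add: numeral_2_eq_2 algebra_simps)
  qed
  then show "coeff (p n m) 0 = 1" and "coeff (p n m) 1 = of_nat (n + m) * a"
    and "coeff (p n m) 2 = of_nat ((n + m) choose 2) * a ^ 2 + of_nat m * b" by auto
qed

text \<open>Pascal's rule adds \<open>n\<close> at each step, so the parity has period 4. The
  residues are phrased by divisibility to suit \<open>presburger\<close>.\<close>

lemma odd_choose_two: "odd (n choose 2) \<longleftrightarrow> 4 dvd n + 1 \<or> 4 dvd n + 2"
proof (induction n)
  case (Suc n)
  have "Suc n choose 2 = n + (n choose 2)" by (simp add: numeral_2_eq_2)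
  then have "odd (Suc n choose 2) \<longleftrightarrow> odd n \<noteq> (4 dvd n + 1 \<or> 4 dvd n + 2)"
    using Suc by (simp only: even_add) blast
  also have "\<dots> \<longleftrightarrow> 4 dvd Suc n + 1 \<or> 4 dvd Suc n + 2" by presburger
  finally show ?case .
qed (simp add: binomial_eq_0, presburger)

text \<open>Each generator divides its own total square, and the Thom factor is exactly the quotient
  of \<open>Sq_S w2\<close> by \<open>w2\<close>. Hence \<open>u\<close> behaves like one more
  factor \<open>w2\<close>, which explains the exponent \<open>Suc m\<close>.\<close>

lemma Sq_S_vMO:
  "[:1, w1, w2:] * Sq_S (vMO n m) =
     Polynomial.smult (vMO n m) ([:1, w1:] ^ n * [:1, w1, w2:] ^ Suc m)"
proof -
  have 1: "Sq_S w1 = Polynomial.smult w1 [:1, w1:]"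
    by (simp add: Sq_S_w power2_eq_square)
  have 2: "Sq_S w2 = Polynomial.smult w2 [:1, w1, w2:]"
    by (simp add: Sq_S_w power2_eq_square mult.commute)
  have "Sq_S (vMO n m) = Polynomial.smult (vMO n m) ([:1, w1:] ^ n * [:1, w1, w2:] ^ m)"
    unfolding vMO_def Sq_S.hom_mult Sq_S.hom_power 1 2 smult_power
    by (simp only: mult_smult_left mult_smult_right smult_smult mult.commute)
  then show ?thesis by (simp only: mult_smult_right power_Suc mult.left_commute)
qed

lemma Sq_M_1_vMO: "Sq_M 1 (vMO n m) = (if even (n + m) then vMO (Suc n) m else 0)"
  using coeff_truncated_powers(2)[of w1 n w2 "Suc m"]
  unfolding Sq_M_def Sq_S_vMO coeff_smult of_nat_S
  by (simp add: vMO_def)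

lemma Sq_M_2_vMO:
  "Sq_M 2 (vMO n m) =
     (if 4 dvd n + m + 2 \<or> 4 dvd n + m + 3 then vMO (n + 2) m else 0) + (if even m then vMO n (Suc m) else 0)"
proof -
  have "4 dvd n + Suc m + 1 \<or> 4 dvd n + Suc m + 2 \<longleftrightarrow> 4 dvd n + m + 2 \<or> 4 dvd n + m + 3"
    by (simp add: numeral_eq_Suc)
  then show ?thesis
    unfolding Sq_M_def Sq_S_vMO coeff_smult coeff_truncated_powers(3) of_nat_S odd_choose_two
    by (simp add: vMO_def algebra_simps power2_eq_square)
qed

lemma Sq_M_add: "Sq_M k (s + t) = Sq_M k s + Sq_M k t"
  by (simp add: Sq_M_def Sq_S.hom_add distrib_left)

lemma Sq_M_zero: "Sq_M k 0 = 0"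
  by (simp add: Sq_M_def)

section \<open>Graded pieces\<close>

interpretation MO2: vectorspace "class_ring :: bit ring" MO2
  by (rule MO2_vectorspace)

lemma MO2_simps [simp]: "carrier MO2 = UNIV" "\<zero>\<^bsub>MO2\<^esub> = 0" "s \<oplus>\<^bsub>MO2\<^esub> t = s + t" "c \<odot>\<^bsub>MO2\<^esub> s = Polynomial.smult [:c:] s"
  by (simp_all add: MO2_def)

lemma MO2_deg_eq: "MO2_deg h = MO2\<lparr>carrier := carrier (MO2_deg h)\<rparr>"
  by (simp add: MO2_deg_def)

lemma MO2_deg_simps [simp]:
  "\<zero>\<^bsub>MO2_deg h\<^esub> = 0" "s \<oplus>\<^bsub>MO2_deg h\<^esub> t = s + t" "c \<odot>\<^bsub>MO2_deg h\<^esub> s = Polynomial.smult [:c:] s"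
  by (simp_all add: MO2_deg_def)

lemma eMO_image: "{vMO n m | n m. n + 2 * m = h} = eMO h ` {..h div 2}" (is "?A = ?B")
proof
  show "?A \<subseteq> ?B"
  proof
    fix x assume "x \<in> ?A"
    then obtain n m where *: "x = vMO n m" "n + 2 * m = h" by blast
    then have "x = eMO h m" by (auto simp: eMO_def)
    moreover have "m \<in> {..h div 2}" using * by auto
    ultimately show "x \<in> ?B" by blast
  qed
  show "?B \<subseteq> ?A"
    by (force simp: eMO_def)
qed

lemma carrier_MO2_deg: "carrier (MO2_deg h) = MO2.span (eMO h ` {..h div 2})"
  by (simp add: MO2_deg_def eMO_image)

text \<open>The only scalars are 0 and 1, so additive closure suffices.\<close>

lemma MO2_submoduleI:
  assumes "0 \<in> W" and "\<And>s t. s \<in> W \<Longrightarrow> t \<in> W \<Longrightarrow> s + t \<in> W"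
  shows "submodule class_ring W MO2"
proof
  fix c :: bit and s assume "s \<in> W"
  then show "c \<odot>\<^bsub>MO2\<^esub> s \<in> W"
    using assms by (cases c) (simp_all add: one_pCons[symmetric])
qed (use assms in \<open>auto intro: MO2.module_axioms\<close>)

lemma submodule_MO2_deg: "submodule class_ring (carrier (MO2_deg h)) MO2"
  unfolding carrier_MO2_deg by (rule MO2.span_is_submodule) simp

lemma MO2_deg_vectorspace: "vectorspace class_ring (MO2_deg h)"
  by (subst MO2_deg_eq)
    (use MO2.submodule_is_module[OF submodule_MO2_deg] class_field in \<open>simp add: vectorspace_def\<close>)

lemma submodule_MO2_deg_iff:
  "submodule class_ring W (MO2_deg h) \<longleftrightarrow> submodule class_ring W MO2 \<and> W \<subseteq> carrier (MO2_deg h)"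
  using MO2_deg_vectorspace[of h] MO2.module_axioms
  by (auto simp: submodule_def vectorspace_def)

lemma eMO_in_MO2_deg: "m \<le> h div 2 \<Longrightarrow> eMO h m \<in> carrier (MO2_deg h)"
  unfolding carrier_MO2_deg using MO2.in_own_span[of "eMO h ` {..h div 2}"] by auto

lemma MO2_deg_subset:
  assumes "submodule class_ring W MO2" and "\<And>m. m \<le> h div 2 \<Longrightarrow> eMO h m \<in> W"
  shows "carrier (MO2_deg h) \<subseteq> W"
  unfolding carrier_MO2_deg using assms by (intro MO2.span_is_subset) auto

section \<open>Separated bases and nonzero minors\<close>

text \<open>The subspace \<open>W k\<close> plays the role of the kernel of the k-th coordinate
  functional. A relation with nonzero coefficient at \<open>f k\<close> would put \<open>f k\<close>
  into the span of the other vectors, which lies in \<open>W k\<close>. Subspaces, unlike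
  functionals, pass to quotients simply as images.\<close>

lemma (in vectorspace) separated_basis:
  assumes I: "finite I" and f: "f ` I \<subseteq> carrier V"
    and W: "\<And>k. k \<in> I \<Longrightarrow> submodule K (W k) V"
    and sep: "\<And>j k. j \<in> I \<Longrightarrow> k \<in> I \<Longrightarrow> f j \<in> W k \<longleftrightarrow> j \<noteq> k"
    and gen: "span (f ` I) = carrier V"
  shows "inj_on f I" "basis (f ` I)" "dim = card I"
proof -
  show inj: "inj_on f I"
    using sep by (metis inj_onI)
  have "lin_indpt (f ` I)"
  proof (rule finite_lin_indpt2)
    fix a assume a: "a \<in> f ` I \<rightarrow> carrier K" and 0: "lincomb a (f ` I) = \<zero>\<^bsub>V\<^esub>"
    show "\<forall>v\<in>f ` I. a v = \<zero>\<^bsub>K\<^esub>"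
    proof (rule ballI, rule ccontr)
      fix v assume v: "v \<in> f ` I" "a v \<noteq> \<zero>\<^bsub>K\<^esub>"
      then obtain k where k: "k \<in> I" "v = f k" by blast
      have "v \<in> span (f ` I - {v})"
        using lincomb_isolate(2)[OF _ f a] I v 0 by blast
      also have "\<dots> \<subseteq> W k"
        using sep k by (intro span_is_subset W) auto
      finally show False using sep k by blast
    qed
  qed (use I f in auto)
  then show "basis (f ` I)"
    using f gen by (simp add: basis_def)
  then show "dim = card I"
    using dim_basis[of "f ` I"] I inj by (simp add: card_image)
qed

section \<open>Submodules and separated bases of quotient modules\<close>

lemma quotient_module_simps:
  "carrier (quotient_module V N) = (\<lambda>x. N +>\<^bsub>V\<^esub> x) ` carrier V" "\<zero>\<^bsub>quotient_module V N\<^esub> = N"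
  by (auto simp: quotient_module_def A_RCOSETS_def')

lemma quotient_module_add:
  fixes R and V (structure)
  assumes N: "submodule R N V" and "x \<in> carrier V" "y \<in> carrier V"
  shows "(N +>\<^bsub>V\<^esub> x) \<oplus>\<^bsub>quotient_module V N\<^esub> (N +>\<^bsub>V\<^esub> y) = N +>\<^bsub>V\<^esub> (x \<oplus>\<^bsub>V\<^esub> y)"
proof -
  interpret abelian_subgroup N V using N by (rule submodule_abelian_subgroup)
  show ?thesis using assms a_rcos_sum by (simp add: quotient_module_def)
qed

lemma submodule_coset_eq_self:
  fixes R and V (structure)
  assumes N: "submodule R N V" and "x \<in> N"
  shows "N +>\<^bsub>V\<^esub> x = N"
proof -
  interpret submodule R N V by fact
  interpret module R V by (rule module)
  interpret abelian_subgroup N V using N by (rule submodule_abelian_subgroup)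
  show ?thesis using assms by (metis a_rcos_const)
qed

lemma quotient_module_submodule:
  fixes R and V (structure)
  assumes N: "submodule R N V" and W: "submodule R W V" and "N \<subseteq> W"
  shows "submodule R ((\<lambda>x. N +>\<^bsub>V\<^esub> x) ` W) (quotient_module V N)"
proof -
  interpret W: submodule R W V by fact
  note sub = subsetD[OF W.subset]
  show ?thesis
  proof (rule submodule.intro)
    show "module R (quotient_module V N)" by (rule quotient_module_module[OF N])
    show "(\<lambda>x. N +>\<^bsub>V\<^esub> x) ` W \<subseteq> carrier (quotient_module V N)"
      using W.subset by (auto simp: quotient_module_simps)
    show "\<zero>\<^bsub>quotient_module V N\<^esub> \<in> (\<lambda>x. N +>\<^bsub>V\<^esub> x) ` W"
      using submodule_coset_eq_self[OF N, of "\<zero>\<^bsub>V\<^esub>"] submodule.zero_closed[OF N] W.zero_closed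
      by (force simp: quotient_module_simps)
  qed (auto simp: quotient_module_add[OF N] quotient_module_smult[OF N] sub
        simp del: W.smult_closed intro!: imageI W.smult_closed W.m_closed)
qed

text \<open>Two representatives of a coset differ by an element of \<open>N\<close>, hence of
  \<open>W\<close>, so membership in \<open>W\<close> does not depend on the representative.\<close>

lemma coset_mem_image_iff:
  fixes R and V (structure)
  assumes N: "submodule R N V" and W: "submodule R W V" and NW: "N \<subseteq> W" and x: "x \<in> carrier V"
  shows "N +>\<^bsub>V\<^esub> x \<in> (\<lambda>x. N +>\<^bsub>V\<^esub> x) ` W \<longleftrightarrow> x \<in> W"
proof
  interpret W: submodule R W V by fact
  interpret module R V by (rule W.module)
  interpret abelian_subgroup N V using N by (rule submodule_abelian_subgroup)
  assume "N +>\<^bsub>V\<^esub> x \<in> (\<lambda>x. N +>\<^bsub>V\<^esub> x) ` W"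
  then obtain w where w: "w \<in> W" "N +>\<^bsub>V\<^esub> x = N +>\<^bsub>V\<^esub> w" by blast
  then have "x \<in> N +>\<^bsub>V\<^esub> w" using a_rcos_self[OF x] by simp
  then obtain n where "n \<in> N" "x = n \<oplus>\<^bsub>V\<^esub> w" unfolding a_r_coset_def' by blast
  then show "x \<in> W" using w NW by auto
qed blast

text \<open>Carries \<open>separated_basis\<close> over to the quotient while all hypotheses remain
  about \<open>V\<close>. Generation is expressed through submodules \<open>U\<close> containing
  \<open>N\<close>, so that no span of cosets has to be computed by the user of the lemma.\<close>

lemma quotient_module_separated_basis:
  fixes K and V (structure)
  assumes V: "vectorspace K V" and N: "submodule K N V"
    and I: "finite I" and f: "f ` I \<subseteq> carrier V"
    and W: "\<And>k. k \<in> I \<Longrightarrow> submodule K (W k) V \<and> N \<subseteq> W k"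
    and sep: "\<And>j k. j \<in> I \<Longrightarrow> k \<in> I \<Longrightarrow> f j \<in> W k \<longleftrightarrow> j \<noteq> k"
    and gen: "\<And>U. submodule K U V \<Longrightarrow> N \<subseteq> U \<Longrightarrow> f ` I \<subseteq> U \<Longrightarrow> carrier V \<subseteq> U"
  shows "inj_on (\<lambda>i. N +>\<^bsub>V\<^esub> f i) I"
    and "vectorspace.basis K (quotient_module V N) ((\<lambda>i. N +>\<^bsub>V\<^esub> f i) ` I)"
    and "vectorspace.dim K (quotient_module V N) = card I"
proof -
  let ?Q = "quotient_module V N" and ?g = "\<lambda>i. N +>\<^bsub>V\<^esub> f i"
  interpret V: vectorspace K V by fact
  interpret Q: vectorspace K ?Q
    using quotient_module_module[OF N] V by (simp add: vectorspace_def)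
  interpret N: submodule K N V by fact
  have g: "?g ` I \<subseteq> carrier ?Q"
    using f by (auto simp: quotient_module_simps)
  interpret S: submodule K "Q.span (?g ` I)" ?Q
    by (rule Q.span_is_submodule[OF g])
  \<comment> \<open>The preimage in \<open>V\<close> of the span of the classes; once it is all of
    \<open>V\<close>, the classes span the quotient.\<close>
  define U where "U = {x \<in> carrier V. N +>\<^bsub>V\<^esub> x \<in> Q.span (?g ` I)}"
  have U: "submodule K U V"
  proof (rule submodule.intro)
    show "module K V" by (rule V.module_axioms)
    show "\<zero>\<^bsub>V\<^esub> \<in> U"
      using S.zero_closed by (simp add: U_def submodule_coset_eq_self[OF N] quotient_module_simps)
  qed (use S.m_closed S.smult_closed in
      \<open>auto simp: U_def quotient_module_add[OF N, symmetric] quotient_module_smult[OF N, symmetric]\<close>)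
  have "N \<subseteq> U"
    using N.subset S.zero_closed
    by (auto simp: U_def submodule_coset_eq_self[OF N] quotient_module_simps)
  moreover have "f ` I \<subseteq> U"
    using f Q.in_own_span[OF g] by (auto simp: U_def)
  ultimately have "carrier V \<subseteq> U" by (rule gen[OF U])
  then have gen': "Q.span (?g ` I) = carrier ?Q"
    using Q.span_is_subset2[OF g] by (auto simp: U_def quotient_module_simps)
  have sub: "submodule K ((\<lambda>x. N +>\<^bsub>V\<^esub> x) ` W k) ?Q" if "k \<in> I" for k
    using W that by (intro quotient_module_submodule N) auto
  have sep': "?g j \<in> (\<lambda>x. N +>\<^bsub>V\<^esub> x) ` W k \<longleftrightarrow> j \<noteq> k" if "j \<in> I" "k \<in> I" for j k
    using coset_mem_image_iff[OF N, of "W k" "f j"] W[of k] sep[of j k] f that by auto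
  note * = Q.separated_basis[OF I g sub sep' gen']
  show "inj_on ?g I" "Q.basis (?g ` I)" "Q.dim = card I"
    by (rule *; assumption)+
qed

section \<open>Nonvanishing minors and rank\<close>

text \<open>A vanishing determinant yields a nonzero vector in the left kernel of the submatrix.
  Extended by zero to the rows outside \<open>I\<close>, it contradicts \<open>kernel\<close>. This
  form avoids any ordering of rows and columns into triangular shape.\<close>

lemma det_submatrix_nonzero:
  fixes A :: "'a :: field mat"
  assumes I: "I \<subseteq> {..<dim_row A}" and J: "J \<subseteq> {..<dim_col A}" and card: "card I = card J"
    and kernel: "\<And>X i. (\<And>i. i \<notin> I \<Longrightarrow> X i = 0) \<Longrightarrow>
      (\<And>j. j \<in> J \<Longrightarrow> (\<Sum>i<dim_row A. X i * A $$ (i, j)) = 0) \<Longrightarrow> i \<in> I \<Longrightarrow> X i = 0"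
  shows "det (submatrix A I J) \<noteq> 0"
proof
  let ?S = "submatrix A I J"
  define n where "n = card I"
  have I': "{i. i < dim_row A \<and> i \<in> I} = I" and J': "{j. j < dim_col A \<and> j \<in> J} = J"
    using I J by auto
  have S: "?S \<in> carrier_mat n n"
    by (intro carrier_matI) (simp_all add: dim_submatrix I' J' card n_def)
  have bij: "bij_betw (pick I) {..<n} I"
  proof (rule bij_betwI')
    fix i j assume "i \<in> {..<n}" "j \<in> {..<n}"
    then show "pick I i = pick I j \<longleftrightarrow> i = j"
      using pick_mono_le[of i I j] pick_mono_le[of j I i] unfolding n_def
      by (metis lessThan_iff less_irrefl linorder_neqE_nat)
  next
    fix i assume "i \<in> {..<n}"
    then show "pick I i \<in> I" using pick_in_set_le unfolding n_def by auto
  next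
    fix i assume i: "i \<in> I"
    have "card {a \<in> I. a < i} < n"
      unfolding n_def using i I by (intro psubset_card_mono) (auto intro: finite_subset)
    moreover have "i = pick I (card {a \<in> I. a < i})"
      using pick_card_in_set[OF i] by simp
    ultimately show "\<exists>x\<in>{..<n}. i = pick I x" by blast
  qed
  assume "det ?S = 0"
  then have "det (transpose_mat ?S) = 0"
    using det_transpose[OF S] by simp
  then obtain v where v: "v \<in> carrier_vec n" "v \<noteq> 0\<^sub>v n" "transpose_mat ?S *\<^sub>v v = 0\<^sub>v n"
    using det_0_iff_vec_prod_zero_field[of "transpose_mat ?S" n] S by auto
  \<comment> \<open>The left kernel vector, transported from positions in the submatrix back to row
    indices and extended by zero.\<close>
  define X where "X = (\<lambda>i. if i \<in> I then v $ inv_into {..<n} (pick I) i else 0)"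
  have X_pick: "X (pick I i) = v $ i" if "i < n" for i
    using that bij_betwE[OF bij] bij_betw_inv_into_left[OF bij] by (auto simp: X_def)
  have "(\<Sum>i<dim_row A. X i * A $$ (i, j)) = 0" if "j \<in> J" for j
  proof -
    define l where "l = card {a \<in> J. a < j}"
    have l: "l < n" unfolding l_def n_def card
      using that J by (intro psubset_card_mono) (auto intro: finite_subset)
    have j: "j = pick J l" using pick_card_in_set[OF that] by (simp add: l_def)
    have "(\<Sum>i<dim_row A. X i * A $$ (i, j)) = (\<Sum>i\<in>I. X i * A $$ (i, j))"
      using I by (intro sum.mono_neutral_right) (auto simp: X_def)
    also have "\<dots> = (\<Sum>i<n. X (pick I i) * A $$ (pick I i, j))"
      using sum.reindex_bij_betw[OF bij, of "\<lambda>i. X i * A $$ (i, j)"] by simp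
    also have "\<dots> = (\<Sum>i<n. ?S $$ (i, l) * v $ i)"
      using l by (intro sum.cong) (auto simp: X_pick submatrix_index I' J' n_def card j)
    also have "\<dots> = (transpose_mat ?S *\<^sub>v v) $ l"
      using S v(1) l by (auto simp: scalar_prod_def atLeast0LessThan)
    also have "\<dots> = 0" using v(3) l by simp
    finally show ?thesis .
  qed
  then have "X i = 0" if "i \<in> I" for i
    using kernel[of X i] that by (simp add: X_def)
  then have "v = 0\<^sub>v n"
    using v(1) X_pick bij_betwE[OF bij] by (intro eq_vecI) auto
  with v(2) show False by simp
qed

lemma rank_eq_dim_row:
  fixes A :: "'a :: field mat"
  assumes "det (submatrix A {..<dim_row A} J) \<noteq> 0"
  shows "vec_space.rank (dim_row A) A = dim_row A"
proof -
  interpret vec_space "TYPE('a)" "dim_row A" .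
  have A: "A \<in> carrier_mat (dim_row A) (dim_col A)" by simp
  \<comment> \<open>\<open>det\<close> is 0 on nonsquare matrices by definition, so the nonzero
    value forces the number of selected columns to match.\<close>
  have "dim_row (submatrix A {..<dim_row A} J) = dim_col (submatrix A {..<dim_row A} J)"
    using assms by (metis det_def)
  then have "card {j. j < dim_col A \<and> j \<in> J} = dim_row A"
    by (simp add: dim_submatrix)
  then have "dim_row A \<le> rank A"
    using rank_gt_minor[OF A assms] by simp
  moreover obtain S where S: "maximal S (\<lambda>T. T \<subseteq> set (cols A) \<and> lin_indpt T)"
    using maximal_exists_superset[of "set (cols A)" "\<lambda>T. T \<subseteq> set (cols A) \<and> lin_indpt T" "{}"]
    by (auto simp: lin_dep_def)
  moreover have "card S \<le> dim_row A"
  proof -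
    have "S \<subseteq> carrier_vec (dim_row A)" "lin_indpt S"
      using S cols_dim[of A] unfolding maximal_def by blast+
    then show ?thesis using li_le_dim(2)[OF fin_dim] dim_is_n by simp
  qed
  ultimately show ?thesis using rank_card_indpt[OF A S] by simp
qed

section \<open>Surviving basis vectors\<close>

text \<open>The indices occurring in \<open>Gset h\<close>. The single condition
  \<open>4 dvd h + m + 2\<close> says \<open>m mod 4 = 2\<close> when \<open>h mod 4 = 0\<close>,
  and \<open>m mod 4 = 0\<close> when \<open>h mod 4 = 2\<close>.\<close>

definition survivors :: "nat \<Rightarrow> nat set" where
  "survivors h = {m. even h \<and> m \<le> h div 2 \<and>
     (4 dvd h + m + 2 \<or> m = h div 2 \<and> (8 dvd h \<or> 8 dvd h + 2))}"

lemma survivors_le: "m \<in> survivors h \<Longrightarrow> m \<le> h div 2"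
  by (simp add: survivors_def)

lemma finite_survivors [simp]: "finite (survivors h)"
  by (rule finite_subset[of _ "{..h div 2}"]) (auto simp: survivors_le)

lemma survivors_odd: "odd h \<Longrightarrow> survivors h = {}"
  by (simp add: survivors_def)

text \<open>With \<open>h = 2 * g\<close> the conditions modulo 8 become conditions modulo 4 on
  \<open>g\<close>, a form within easy reach of \<open>presburger\<close>.\<close>

lemma survivors_double:
  "m \<in> survivors (2 * g) \<longleftrightarrow> m \<le> g \<and> (4 dvd 2 * g + m + 2 \<or> m = g \<and> (4 dvd g \<or> 4 dvd g + 1))"
proof -
  have "8 dvd 2 * g \<longleftrightarrow> 4 dvd g" "8 dvd 2 * g + 2 \<longleftrightarrow> 4 dvd g + 1" by presburger+
  then show ?thesis by (simp add: survivors_def)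
qed

lemma Gset_eq:
  assumes "even h"
  shows "Gset h = eMO h ` survivors h"
proof -
  obtain g where h: "h = 2 * g" using assms by blast
  have img: "{eMO h (c + 4 * a) | a. c + 4 * a \<le> h div 2} = eMO h ` {m. m \<le> g \<and> m mod 4 = c}"
    if "c < 4" for c
  proof -
    have "m mod 4 = c \<longleftrightarrow> (\<exists>a. m = c + 4 * a)" for m
    proof
      assume "m mod 4 = c"
      then have "m = c + 4 * (m div 4)" by auto
      then show "\<exists>a. m = c + 4 * a" ..
    qed (use that in auto)
    then show ?thesis by (auto simp: h)
  qed
  have m4: "m mod 4 = 0 \<longleftrightarrow> 4 dvd m" "m mod 4 = 2 \<longleftrightarrow> 4 dvd m + 2" for m :: nat by presburger+
  show ?thesis
  proof (cases "even g")
    case True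
    then have "h mod 4 = 0" "h mod 8 = 0 \<longleftrightarrow> 4 dvd g" unfolding h by presburger+
    moreover have "m \<in> survivors h \<longleftrightarrow> m \<le> g \<and> 4 dvd m + 2 \<or> 4 dvd g \<and> m = g" for m
      using True unfolding h survivors_double by presburger
    then have "survivors h = {m. m \<le> g \<and> m mod 4 = 2} \<union> (if 4 dvd g then {g} else {})"
      unfolding m4 by auto
    ultimately show ?thesis
      using img[of 2] by (simp add: Gset_def) (simp add: h)
  next
    case False
    then have "h mod 4 \<noteq> 0" "h mod 8 = 6 \<longleftrightarrow> 4 dvd g + 1" unfolding h by presburger+
    moreover have "m \<in> survivors h \<longleftrightarrow> m \<le> g \<and> 4 dvd m \<or> 4 dvd g + 1 \<and> m = g" for m
      using False unfolding h survivors_double by presburger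
    then have "survivors h = {m. m \<le> g \<and> m mod 4 = 0} \<union> (if 4 dvd g + 1 then {g} else {})"
      unfolding m4 by auto
    ultimately show ?thesis
      using img[of 0] by (simp add: Gset_def) (simp add: h)
  qed
qed

text \<open>For each residue of \<open>g = h div 2\<close> modulo 4 the survivors form a progression
  of step 4, with the extra top index \<open>g\<close> exactly when \<open>g mod 4\<close> is 0 or
  3.\<close>

lemma card_survivors:
  "card (survivors h) = (if odd h then 0 else (h + 2) div 8 + 1)"
proof (cases "odd h")
  case False
  then obtain g where h: "h = 2 * g" by blast
  have card: "card {m. 4 dvd m + c \<and> m < 4 * n} = n" if "c \<in> {0, 2}" for c n :: nat
  proof -
    have "bij_betw (\<lambda>a. 4 * a + c) {..<n} {m. 4 dvd m + c \<and> m < 4 * n}"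
      using that by (intro bij_betw_byWitness[where f' = "\<lambda>m. m div 4"]) (auto, presburger+)
    then show ?thesis using bij_betw_same_card by fastforce
  qed
  have fin: "finite {m. 4 dvd m + c \<and> m < 4 * n}" for c n :: nat
    by simp
  define q where "q = g div 4"
  consider "g = 4 * q" | "g = 4 * q + 1" | "g = 4 * q + 2" | "g = 4 * q + 3"
    unfolding q_def by (atomize_elim; presburger)
  then show ?thesis
  proof cases
    case 1
    have "m \<in> survivors h \<longleftrightarrow> m = 4 * q \<or> 4 dvd m + 2 \<and> m < 4 * q" for m
      unfolding h survivors_double 1 by presburger
    then have "survivors h = insert (4 * q) {m. 4 dvd m + 2 \<and> m < 4 * q}" by blast
    then show ?thesis using card[of 2 q] fin[of 2 q] by (simp add: h 1)
  next
    case 2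
    have "m \<in> survivors h \<longleftrightarrow> 4 dvd m + 0 \<and> m < 4 * Suc q" for m
      unfolding h survivors_double 2 by presburger
    then have "survivors h = {m. 4 dvd m + 0 \<and> m < 4 * Suc q}" by blast
    then show ?thesis using card[of 0 "Suc q"] by (simp add: h 2)
  next
    case 3
    have "m \<in> survivors h \<longleftrightarrow> 4 dvd m + 2 \<and> m < 4 * Suc q" for m
      unfolding h survivors_double 3 by presburger
    then have "survivors h = {m. 4 dvd m + 2 \<and> m < 4 * Suc q}" by blast
    then show ?thesis using card[of 2 "Suc q"] by (simp add: h 3)
  next
    case 4
    have "m \<in> survivors h \<longleftrightarrow> m = 4 * q + 3 \<or> 4 dvd m + 0 \<and> m < 4 * Suc q" for m
      unfolding h survivors_double 4 by presburger
    then have "survivors h = insert (4 * q + 3) {m. 4 dvd m + 0 \<and> m < 4 * Suc q}" by blast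
    moreover have "4 * q + 3 \<notin> {m. 4 dvd m + 0 \<and> m < 4 * Suc q}"
      unfolding mem_Collect_eq by presburger
    moreover have "(h + 2) div 8 = Suc q" by (simp add: h 4)
    ultimately show ?thesis using card[of 0 "Suc q"] fin[of 0 "Suc q"] False by simp
  qed
qed (simp add: survivors_odd)

section \<open>Functionals on the indecomposables\<close>

text \<open>Reading off the coefficient of \<open>eMO h k\<close> in the quotient by \<open>A1_plus_M\<close>. For \<open>h mod 8 = 6\<close> the classes
  of \<open>eMO h (h div 2)\<close> and \<open>eMO h (h div 2 - 1)\<close> agree and are nonzero, hence the second summand.\<close>

definition dual_coord :: "nat \<Rightarrow> nat \<Rightarrow> S \<Rightarrow> bit" where
  "dual_coord h k s = coeff (coeff s k) (h - 2 * k)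
     + (if h = 2 * k \<and> 4 dvd k + 1 then coeff (coeff s (k - 1)) 2 else 0)"

lemma dual_coord_add: "dual_coord h k (s + t) = dual_coord h k s + dual_coord h k t"
  by (simp add: dual_coord_def)

lemma dual_coord_zero [simp]: "dual_coord h k 0 = 0"
  by (simp add: dual_coord_def)

lemma dual_coord_vMO:
  "dual_coord h k (vMO n m) = (if k = m \<and> n = h - 2 * k then 1 else 0)
     + (if h = 2 * k \<and> 4 dvd k + 1 \<and> m = k - 1 \<and> n = 2 then 1 else 0)"
  unfolding dual_coord_def coeff_vMO by (rule arg_cong2[where f = "(+)"]) auto

text \<open>Here \<open>2 * d\<close> is the exponent of \<open>w1\<close> in
  \<open>eMO h k\<close>; naming it removes truncated subtraction from the parity arguments that
  follow.\<close>

lemma survivors_cases [consumes 1, case_names low top]: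
  assumes "k \<in> survivors h"
  obtains d where "h = 2 * k + 2 * d" "even k" "odd d \<longleftrightarrow> 4 dvd k" | "h = 2 * k" "4 dvd k \<or> 4 dvd k + 1"
proof -
  obtain g where h: "h = 2 * g" using assms survivors_odd by blast
  with assms obtain d where g: "g = k + d" unfolding h survivors_double using le_Suc_ex by blast
  have "even k" "odd d \<longleftrightarrow> 4 dvd k" if "4 dvd 2 * (k + d) + k + 2"
    using that by presburger+
  then show ?thesis
    using assms that unfolding h g survivors_double by auto
qed

text \<open>Sq^1 only produces \<open>vMO (Suc n) m\<close> with \<open>n + m\<close> even. The
  monomials read by \<open>dual_coord\<close> have an even exponent of \<open>w1\<close> and, if
  that is positive, also an even exponent of \<open>w2\<close>.\<close>

lemma dual_coord_Sq_M_1: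
  assumes "k \<in> survivors h"
  shows "dual_coord h k (Sq_M 1 s) = 0"
proof (induction s rule: S_monomial_induct)
  case (vMO n m)
  have "\<not> (even (n + m) \<and> k = m \<and> Suc n = h - 2 * k)"
    using assms by (cases rule: survivors_cases) (simp_all, presburger)
  moreover have "\<not> (even (n + m) \<and> 4 dvd k + 1 \<and> m = k - 1 \<and> Suc n = 2)"
    by presburger
  ultimately show ?case by (auto simp: Sq_M_1_vMO dual_coord_vMO simp del: One_nat_def)
qed (simp_all add: Sq_M_add Sq_M_zero dual_coord_add)

text \<open>In the \<open>low\<close> case the residues of \<open>k\<close> and \<open>d\<close>
  exclude the first term of Sq^2, and the evenness of \<open>k\<close> excludes the second. In the
  \<open>top\<close> case both terms can be seen, but only together, and they cancel.\<close>

lemma dual_coord_Sq_M_2: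
  assumes "k \<in> survivors h"
  shows "dual_coord h k (Sq_M 2 s) = 0"
proof (induction s rule: S_monomial_induct)
  case (vMO n m)
  show ?case
    using assms
  proof (cases rule: survivors_cases)
    case (low d)
    have "\<not> ((4 dvd n + m + 2 \<or> 4 dvd n + m + 3) \<and> k = m \<and> n + 2 = 2 * d)"
      using low(2,3) by presburger
    moreover have "\<not> (even m \<and> k = Suc m)" using low(2) by presburger
    moreover have "\<not> 4 dvd k + 1" using low(2) by presburger
    ultimately show ?thesis
      by (auto simp: Sq_M_2_vMO dual_coord_vMO dual_coord_add low(1))
  next
    case top
    \<comment> \<open>\<open>P\<close> says that the source monomial is \<open>vMO 0 (k - 1)\<close>
      with \<open>k mod 4 = 3\<close>: its square is \<open>vMO 2 (k - 1) + vMO 0 k\<close>, and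
      \<open>dual_coord\<close> reads both summands.\<close>
    define P where "P \<longleftrightarrow> 4 dvd k + 1 \<and> m = k - 1 \<and> n = 0"
    have "(4 dvd n + m + 2 \<or> 4 dvd n + m + 3) \<and> 4 dvd k + 1 \<and> m = k - 1 \<and> n = 0 \<longleftrightarrow> P"
      unfolding P_def by presburger
    then have "dual_coord h k (if 4 dvd n + m + 2 \<or> 4 dvd n + m + 3 then vMO (n + 2) m else 0) = (if P then 1 else 0)"
      by (auto simp: dual_coord_vMO top(1))
    moreover have 2: "even m \<and> k = Suc m \<and> n = 0 \<longleftrightarrow> P"
      using top(2) unfolding P_def by presburger
    have "\<not> (even m \<and> 4 dvd k + 1 \<and> Suc m = k - 1)" by presburger
    with 2 have "dual_coord h k (if even m then vMO n (Suc m) else 0) = (if P then 1 else 0)"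
      by (auto simp: dual_coord_vMO top(1))
    ultimately show ?thesis by (simp add: Sq_M_2_vMO dual_coord_add)
  qed
qed (simp_all add: Sq_M_add Sq_M_zero dual_coord_add)

text \<open>The correction term of \<open>dual_coord\<close> reads index \<open>k - 1\<close> only
  if \<open>k mod 4 = 3\<close> and \<open>h = 2 * k\<close>, and then \<open>k - 1\<close> is not a
  survivor.\<close>

lemma dual_coord_eMO:
  assumes "j \<in> survivors h" "k \<in> survivors h"
  shows "dual_coord h k (eMO h j) = (if j = k then 1 else 0)"
proof -
  have "\<not> (h = 2 * k \<and> 4 dvd k + 1 \<and> j = k - 1)"
  proof
    assume *: "h = 2 * k \<and> 4 dvd k + 1 \<and> j = k - 1"
    then have "k = Suc j" by presburger
    with * assms(1) show False using survivors_double[of j "Suc j"] by simp presburger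
  qed
  then show ?thesis by (auto simp: eMO_def dual_coord_vMO)
qed

section \<open>The indecomposables\<close>

lemma submodule_A1_plus_M: "submodule class_ring A1_plus_M MO2"
  unfolding A1_plus_M_def by (rule MO2.span_is_submodule) simp

lemma A1_in_A1_plus_M: "d > 0 \<Longrightarrow> A1 d \<theta> \<Longrightarrow> \<theta> s \<in> A1_plus_M"
  unfolding A1_plus_M_def using MO2.in_own_span[of "{\<theta> s | d \<theta> s. d > 0 \<and> A1 d \<theta>}"] by auto

text \<open>In a composite the outer factor already lands in \<open>W\<close> if its degree is
  positive. Otherwise it has degree 0, hence is the identity or zero; carrying this fact through the
  induction settles the remaining composites.\<close>

lemma A1_plus_M_subset:
  assumes "submodule class_ring W MO2"
    and 1: "\<And>s. Sq_M 1 s \<in> W" and 2: "\<And>s. Sq_M 2 s \<in> W"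
  shows "A1_plus_M \<subseteq> W"
proof -
  interpret submodule class_ring W MO2 by fact
  have "(\<forall>s. d > 0 \<longrightarrow> \<theta> s \<in> W) \<and> (d = 0 \<longrightarrow> \<theta> = (\<lambda>s. s) \<or> \<theta> = (\<lambda>s. 0))"
    if "A1 d \<theta>" for d \<theta>
    using that
  proof induction
    case (A1_add d \<theta> \<phi>)
    then show ?case using m_closed by (auto simp: bit_poly_add_self)
  next
    case (A1_mult c \<theta> d \<phi>)
    then show ?case using zero_closed by (cases "c = 0"; cases "d = 0") auto
  qed (use 1 2 zero_closed in auto)
  then show ?thesis
    unfolding A1_plus_M_def by (intro MO2.span_is_subset assms) auto
qed

lemma dual_coord_A1_plus_M:
  assumes "k \<in> survivors h" "s \<in> A1_plus_M"
  shows "dual_coord h k s = 0"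
proof -
  have "A1_plus_M \<subseteq> {s. dual_coord h k s = 0}"
    using assms(1)
    by (intro A1_plus_M_subset MO2_submoduleI) (auto simp: dual_coord_add dual_coord_Sq_M_1 dual_coord_Sq_M_2 simp del: One_nat_def)
  then show ?thesis using assms(2) by blast
qed

text \<open>If Sq^1 does not hit \<open>eMO h m\<close>, then Sq^2 is used: for odd \<open>m\<close>
  on the source with index \<open>m - 1\<close>, for even \<open>m\<close> on the source with index
  \<open>m\<close>. The other term of the relation has zero coefficient or is a Sq^1 image, except
  for even \<open>m = h div 2 - 1\<close>, where the identification with the top vector
  remains.\<close>

lemma eMO_reduction:
  assumes "m \<le> h div 2" "m \<notin> survivors h"
  shows "eMO h m \<in> A1_plus_M \<or> h div 2 \<in> survivors h \<and> eMO h m + eMO h (h div 2) \<in> A1_plus_M"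
proof -
  note A1 = A1_in_A1_plus_M[OF _ A1_Sq1] A1_in_A1_plus_M[OF _ A1_Sq2]
  have add: "s + t \<in> A1_plus_M" if "s \<in> A1_plus_M" "t \<in> A1_plus_M" for s t
    using submodule.m_closed[OF submodule_A1_plus_M that] by simp
  have sq1: "eMO h m \<in> A1_plus_M" if "odd (h + m)" "2 * m < h" for m
  proof -
    obtain n where h: "h = 2 * m + Suc n" using less_imp_Suc_add[OF \<open>2 * m < h\<close>] by auto
    then have "even (n + m)" using \<open>odd (h + m)\<close> by presburger
    then show ?thesis
      using A1(1)[of "eMO (h - 1) m"] by (simp add: eMO_def Sq_M_1_vMO h del: One_nat_def)
  qed
  \<comment> \<open>Modulo 4, \<open>h + 3 * m\<close> is \<open>h - m\<close> without truncated
    subtraction.\<close>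
  have sq2: "(if 4 dvd h + 3 * m \<or> 4 dvd h + 3 * m + 1 then eMO h m else 0) + eMO h (Suc m) \<in> A1_plus_M"
    if "even m" "2 * m + 2 \<le> h" for m
  proof -
    obtain n where h: "h = 2 * m + 2 + n" using le_Suc_ex[OF \<open>2 * m + 2 \<le> h\<close>] by blast
    have mod4: "4 dvd n + m + 2 \<or> 4 dvd n + m + 3 \<longleftrightarrow> 4 dvd h + 3 * m \<or> 4 dvd h + 3 * m + 1"
      unfolding h using \<open>even m\<close> by presburger
    have e: "eMO (h - 2) m = vMO n m" "eMO h m = vMO (n + 2) m" "eMO h (Suc m) = vMO n (Suc m)"
      by (simp_all add: eMO_def h)
    show ?thesis
      using A1(2)[of "eMO (h - 2) m"] \<open>even m\<close> unfolding e Sq_M_2_vMO mod4 by simp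
  qed
  show ?thesis
  proof (cases "odd (h + m) \<and> 2 * m < h")
    case True
    then show ?thesis using sq1 by blast
  next
    case False
    show ?thesis
    proof (cases "odd m")
      case odd: True
      then obtain l where l: "m = Suc l" "even l" by (auto elim: oddE)
      have le: "2 * l + 2 \<le> h" using assms(1) l by auto
      have "\<not> (4 dvd h + 3 * l \<or> 4 dvd h + 3 * l + 1) \<or> eMO h l \<in> A1_plus_M"
      proof (cases "odd h")
        case True
        then show ?thesis using sq1[of l] l le by simp
      next
        case even: False
        then have h: "h = 2 * m" using False odd assms(1) by auto
        then have "\<not> 4 dvd m + 1" using assms(2) unfolding h survivors_double by simp
        then have "\<not> (4 dvd h + 3 * l \<or> 4 dvd h + 3 * l + 1)"
          using l(2) unfolding h l(1) by presburger
        then show ?thesis ..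
      qed
      then have "eMO h (Suc l) \<in> A1_plus_M"
        using sq2[OF l(2) le] add[of "eMO h l" "eMO h l + eMO h (Suc l)"]
        by (auto simp: add.assoc[symmetric] bit_poly_add_self split: if_splits)
      then show ?thesis by (simp add: l)
    next
      case even: False
      have "2 * m < h" if "odd h" using that assms(1) by (auto elim!: oddE)
      then have "even h" using even False by auto
      then obtain g where h: "h = 2 * g" by blast
      have m: "m < g" "4 dvd 2 * g + m"
        using even assms unfolding h survivors_double by (simp_all, presburger+)
      then have "4 dvd h + 3 * m" unfolding h using even by presburger
      then have sum: "eMO h m + eMO h (Suc m) \<in> A1_plus_M"
        using sq2[of m] m even h by (auto split: if_splits)
      show ?thesis
      proof (cases "Suc m < g")
        case True
        then show ?thesis
          using sq1[of "Suc m"] even h add[OF sum, of "eMO h (Suc m)"]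
          by (simp add: add.assoc bit_poly_add_self)
      next
        case False
        then have g: "g = Suc m" using m by simp
        have "4 dvd g + 1" using m(2) even unfolding g by presburger
        then show ?thesis using sum g h survivors_double[of g g] by simp
      qed
    qed
  qed
qed

lemma Qmod_submodule:
  "submodule class_ring (A1_plus_M \<inter> carrier (MO2_deg h)) (MO2_deg h)"
  unfolding submodule_MO2_deg_iff
proof
  interpret N: submodule class_ring A1_plus_M MO2 by (rule submodule_A1_plus_M)
  interpret D: submodule class_ring "carrier (MO2_deg h)" MO2 by (rule submodule_MO2_deg)
  show "submodule class_ring (A1_plus_M \<inter> carrier (MO2_deg h)) MO2"
    using N.m_closed D.m_closed N.zero_closed D.zero_closed
    by (intro MO2_submoduleI IntI) (simp_all only: MO2_simps Int_iff)
qed simp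

lemma submodule_kernel:
  assumes "f 0 = (0 :: bit)" and "\<And>s t. f (s + t) = f s + f t"
  shows "submodule class_ring {s \<in> carrier (MO2_deg h). f s = 0} (MO2_deg h)"
  unfolding submodule_MO2_deg_iff
proof
  interpret submodule class_ring "carrier (MO2_deg h)" MO2 by (rule submodule_MO2_deg)
  show "submodule class_ring {s \<in> carrier (MO2_deg h). f s = 0} MO2"
    using m_closed zero_closed assms by (intro MO2_submoduleI) auto
qed auto

section \<open>Dimension of the graded pieces and the basis of the quotient\<close>

lemma dim_MO2_deg: "vectorspace.dim class_ring (MO2_deg h) = h div 2 + 1"
proof -
  interpret V: vectorspace class_ring "MO2_deg h" by (rule MO2_deg_vectorspace)
  have "V.dim = card {..h div 2}"
  proof (rule V.separated_basis(3))
    show "eMO h ` {..h div 2} \<subseteq> carrier (MO2_deg h)" using eMO_in_MO2_deg by auto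
    show "submodule class_ring {s \<in> carrier (MO2_deg h). coeff (coeff s k) (h - 2 * k) = 0} (MO2_deg h)"
      for k by (rule submodule_kernel) simp_all
    show "(eMO h j \<in> {s \<in> carrier (MO2_deg h). coeff (coeff s k) (h - 2 * k) = 0}) = (j \<noteq> k)"
      if "j \<in> {..h div 2}" "k \<in> {..h div 2}" for j k
      using that eMO_in_MO2_deg[of j h] by (auto simp: eMO_def coeff_vMO)
    show "V.span (eMO h ` {..h div 2}) = carrier (MO2_deg h)"
      using MO2.span_li_not_depend(1)[OF _ submodule_MO2_deg, of "eMO h ` {..h div 2}" h]
        eMO_in_MO2_deg by (auto simp: MO2_deg_eq[symmetric] carrier_MO2_deg[symmetric])
  qed simp
  then show ?thesis by simp
qed

text \<open>The kernels of \<open>dual_coord h k\<close> separate the survivors, and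
  \<open>eMO_reduction\<close> shows that the survivors generate modulo
  \<open>A1_plus_M\<close>.\<close>

lemma Qmod_basis:
  shows "inj_on (\<lambda>m. Q_class h (eMO h m)) (survivors h)"
    and "vectorspace.basis class_ring (Qmod h) ((\<lambda>m. Q_class h (eMO h m)) ` survivors h)"
    and "vectorspace.dim class_ring (Qmod h) = card (survivors h)"
proof -
  let ?N = "A1_plus_M \<inter> carrier (MO2_deg h)"
  let ?W = "\<lambda>k. {s \<in> carrier (MO2_deg h). dual_coord h k s = 0}"
  have e: "eMO h ` survivors h \<subseteq> carrier (MO2_deg h)"
    using eMO_in_MO2_deg survivors_le by blast
  have W: "submodule class_ring (?W k) (MO2_deg h) \<and> ?N \<subseteq> ?W k" if "k \<in> survivors h" for k
    using that by (auto intro!: submodule_kernel simp: dual_coord_add dual_coord_A1_plus_M)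
  have sep: "eMO h j \<in> ?W k \<longleftrightarrow> j \<noteq> k" if "j \<in> survivors h" "k \<in> survivors h" for j k
    using that e by (auto simp: dual_coord_eMO)
  have gen: "carrier (MO2_deg h) \<subseteq> U"
    if U: "submodule class_ring U (MO2_deg h)" and N: "?N \<subseteq> U" and sub: "eMO h ` survivors h \<subseteq> U" for U
  proof (rule MO2_deg_subset)
    show U': "submodule class_ring U MO2" using U by (simp add: submodule_MO2_deg_iff)
    interpret U: submodule class_ring U MO2 by (rule U')
    interpret M: submodule class_ring "carrier (MO2_deg h)" MO2 by (rule submodule_MO2_deg)
    fix m assume m: "m \<le> h div 2"
    have "eMO h m \<in> U" if "h div 2 \<in> survivors h" "eMO h m + eMO h (h div 2) \<in> A1_plus_M"
    proof -
      have "eMO h m + eMO h (h div 2) \<in> U"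
        using N that M.m_closed[OF eMO_in_MO2_deg[OF m] eMO_in_MO2_deg[of "h div 2" h]] by auto
      \<comment> \<open>Adding the top vector, itself a survivor, a second time cancels it in
        characteristic 2.\<close>
      then have "(eMO h m + eMO h (h div 2)) + eMO h (h div 2) \<in> U"
        using sub that(1) U.m_closed[of "eMO h m + eMO h (h div 2)" "eMO h (h div 2)"] by auto
      then show ?thesis by (simp add: add.assoc bit_poly_add_self)
    qed
    then show "eMO h m \<in> U"
      using eMO_reduction[OF m] eMO_in_MO2_deg[OF m] sub N by blast
  qed
  note * = quotient_module_separated_basis[OF MO2_deg_vectorspace Qmod_submodule finite_survivors e W sep gen]
  show "inj_on (\<lambda>m. Q_class h (eMO h m)) (survivors h)"
    and "vectorspace.basis class_ring (Qmod h) ((\<lambda>m. Q_class h (eMO h m)) ` survivors h)"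
    and "vectorspace.dim class_ring (Qmod h) = card (survivors h)"
    unfolding Q_class_def Qmod_def by (rule *; assumption)+
qed

section \<open>The matrix\<close>

lemma dim_Bmat: "dim_row (Bmat h) = h div 2 + 1" "dim_col (Bmat h) = (h + 1) div 2 + h div 2"
proof -
  \<comment> \<open>These counts hold for all \<open>h\<close> without guards, and so the Sq^2
    columns start at index \<open>(h + 1) div 2\<close>.\<close>
  have "(if h \<ge> 1 then (h - 1) div 2 + 1 else 0) = (h + 1) div 2"
    "(if h \<ge> 2 then (h - 2) div 2 + 1 else 0) = h div 2" by presburger+
  then show "dim_col (Bmat h) = (h + 1) div 2 + h div 2"
    by (simp add: Bmat_def split: if_splits)
qed (simp add: Bmat_def)

lemma Bmat_Sq1:
  assumes "i \<le> h div 2" "2 * m < h"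
  shows "Bmat h $$ (i, m) = (if i = m \<and> odd (h + m) then 1 else 0)"
proof -
  obtain n where h: "h = 2 * m + Suc n" using less_imp_Suc_add[OF assms(2)] by auto
  have "m < (h - 1) div 2 + 1" by (simp add: h)
  then have "Bmat h $$ (i, m) = coeff (coeff (Sq_M 1 (vMO n m)) i) (h - 2 * i)"
    using assms h
    by (simp add: Bmat_def mat_of_cols_index nth_append coords_def eMO_def del: One_nat_def)
  moreover have "odd (h + m) \<longleftrightarrow> even (n + m)" unfolding h by presburger
  ultimately show ?thesis
    by (auto simp: Sq_M_1_vMO coeff_vMO h simp del: One_nat_def)
qed

lemma Bmat_Sq2:
  assumes "i \<le> h div 2" "2 * m + 2 \<le> h"
  shows "Bmat h $$ (i, (h + 1) div 2 + m) =
    (if i = m \<and> (4 dvd h + 3 * m \<or> 4 dvd h + 3 * m + 1) then 1 else 0) + (if i = Suc m \<and> even m then 1 else 0)"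
proof -
  obtain n where h: "h = 2 * m + 2 + n" using le_Suc_ex[OF assms(2)] by blast
  have "m < (h - 2) div 2 + 1" "(h - 1) div 2 + 1 = (h + 1) div 2" "1 \<le> h" "2 \<le> h"
    by (simp_all add: h)
  then have "Bmat h $$ (i, (h + 1) div 2 + m) = coeff (coeff (Sq_M 2 (vMO n m)) i) (h - 2 * i)"
    using assms
    by (simp add: Bmat_def mat_of_cols_index nth_append coords_def eMO_def del: One_nat_def) (simp add: h)
  moreover have "4 dvd n + m + 2 \<or> 4 dvd n + m + 3 \<longleftrightarrow> 4 dvd h + 3 * m \<or> 4 dvd h + 3 * m + 1"
    unfolding h by presburger
  ultimately show ?thesis
    by (auto simp: Sq_M_2_vMO coeff_vMO h)
qed

section \<open>Pivot columns and the minor\<close>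

text \<open>The column that kills a row functional in row \<open>m\<close>, a non-survivor: columns below \<open>(h + 1) div 2\<close>
  come from \<open>Sq^1\<close>, the others from \<open>Sq^2\<close>.\<close>

definition pivot :: "nat \<Rightarrow> nat \<Rightarrow> nat" where
  "pivot h m = (if odd (h + m) \<and> 2 * m < h then m else (h + 1) div 2 + (if odd m then m - 1 else m))"

lemma inj_on_pivot: "inj_on (pivot h) ({..h div 2} - survivors h)"
proof (cases "odd h")
  case True
  then obtain g where h: "h = 2 * g + 1" by (auto elim: oddE)
  have "pivot h m = (if even m then m else g + m)" if "m \<le> g" for m
    using that by (auto simp: pivot_def h)
  then show ?thesis
    by (intro inj_onI) (auto simp: h split: if_splits; presburger)
next
  case False
  then obtain g where h: "h = 2 * g" by blast
  \<comment> \<open>The third alternative is the top row, a non-survivor only if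
    \<open>g mod 4 = 1\<close>. Its column \<open>2 * g - 1\<close> would clash with the second kind
    only at \<open>m = g - 1\<close>, which the condition \<open>4 dvd 2 * g + m\<close> rules
    out.\<close>
  have piv: "odd m \<and> m < g \<and> pivot h m = m \<or> even m \<and> m < g \<and> 4 dvd 2 * g + m \<and> pivot h m = g + m \<or>
      m = g \<and> 4 dvd g + 3 \<and> pivot h m + 1 = 2 * g"
    if "m \<in> {..h div 2} - survivors h" for m
  proof -
    have m: "m \<le> g" "\<not> 4 dvd 2 * g + m + 2" "m = g \<Longrightarrow> \<not> 4 dvd g \<and> \<not> 4 dvd g + 1"
      using that unfolding h by (auto simp: survivors_double)
    consider "odd m" "m < g" | "m = g" | "even m" "m < g" using m(1) by linarith
    then show ?thesis
    proof cases
      case 2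
      then have "4 dvd g + 3" "odd g" using m(2,3) by presburger+
      then show ?thesis using 2 by (simp add: pivot_def h)
    next
      case 3
      then have "4 dvd 2 * g + m" using m(2) by presburger
      then show ?thesis using 3 by (simp add: pivot_def h)
    qed (simp add: pivot_def h)
  qed
  show ?thesis
  proof (rule inj_onI)
    fix i j assume ij: "i \<in> {..h div 2} - survivors h" "j \<in> {..h div 2} - survivors h" "pivot h i = pivot h j"
    have "i = j" if "p = q"
      "odd i \<and> i < g \<and> p = i \<or> even i \<and> i < g \<and> 4 dvd 2 * g + i \<and> p = g + i \<or> i = g \<and> 4 dvd g + 3 \<and> p + 1 = 2 * g"
      "odd j \<and> j < g \<and> q = j \<or> even j \<and> j < g \<and> 4 dvd 2 * g + j \<and> q = g + j \<or> j = g \<and> 4 dvd g + 3 \<and> q + 1 = 2 * g"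
      for p q
      using that by (elim disjE conjE; (linarith | presburger))
    from this[OF ij(3) piv[OF ij(1)] piv[OF ij(2)]] show "i = j" .
  qed
qed

lemma pivot_less:
  assumes "m \<in> {..h div 2} - survivors h"
  shows "pivot h m < (h + 1) div 2 + h div 2"
proof (cases "odd h")
  case True
  then obtain g where h: "h = 2 * g + 1" by (auto elim: oddE)
  have "m \<le> g" using assms by (simp add: h)
  moreover from this have "odd m \<Longrightarrow> m - 1 < g" by (cases m) auto
  ultimately show ?thesis by (simp add: pivot_def h)
next
  case False
  then obtain g where h: "h = 2 * g" by blast
  \<comment> \<open>An even top index \<open>g\<close> is always a survivor, so the pivot of the top
    row is shifted by one and stays in range.\<close>
  have "m \<le> g" "odd m \<or> m < g"
    using assms unfolding h by (auto simp: survivors_double) presburger+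
  then show ?thesis by (auto simp: pivot_def h elim: oddE)
qed

text \<open>The case analysis of \<open>eMO_reduction\<close> in dual form: a row functional
  \<open>X\<close> vanishing on survivors and on the pivot columns is zero. Only pivot columns may
  be used, hence the extra premises of \<open>sq2\<close> below.\<close>

lemma Bmat_minor:
  fixes h
  defines "I \<equiv> {..h div 2} - survivors h"
  shows "det (submatrix (Bmat h) I (pivot h ` I)) = 1"
proof -
  have "det (submatrix (Bmat h) I (pivot h ` I)) \<noteq> 0"
  proof (rule det_submatrix_nonzero)
    show "I \<subseteq> {..<dim_row (Bmat h)}" by (auto simp: I_def dim_Bmat)
    show "pivot h ` I \<subseteq> {..<dim_col (Bmat h)}"
      using pivot_less unfolding I_def dim_Bmat by blast
    show "card I = card (pivot h ` I)"
      unfolding I_def by (rule card_image[OF inj_on_pivot, symmetric])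
    fix X i
    assume X: "\<And>i. i \<notin> I \<Longrightarrow> X i = 0" and i: "i \<in> I"
      and "\<And>j. j \<in> pivot h ` I \<Longrightarrow> (\<Sum>i<dim_row (Bmat h). X i * Bmat h $$ (i, j)) = 0"
    then have col: "(\<Sum>i\<le>h div 2. X i * Bmat h $$ (i, pivot h m)) = 0" if "m \<in> I" for m
      using that by (simp add: dim_Bmat lessThan_Suc_atMost)
    have sq1: "X m = 0" if "m \<le> h div 2" "odd (h + m)" "2 * m < h" for m
    proof (cases "m \<in> I")
      case True
      have "(\<Sum>i\<le>h div 2. X i * Bmat h $$ (i, m)) = (\<Sum>i\<le>h div 2. if i = m then X i else 0)"
        using that by (intro sum.cong) (auto simp: Bmat_Sq1)
      then show ?thesis using col[OF True] that by (simp add: pivot_def)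
    qed (rule X)
    have sq2: "(if 4 dvd h + 3 * m \<or> 4 dvd h + 3 * m + 1 then X m else 0) + X (Suc m) = 0"
      if "even m" "2 * m + 2 \<le> h" "pivot h j = (h + 1) div 2 + m" "j \<in> I" for m j
    proof -
      have "(\<Sum>i\<le>h div 2. X i * Bmat h $$ (i, (h + 1) div 2 + m)) =
        (\<Sum>i\<le>h div 2. (if i = m then if 4 dvd h + 3 * m \<or> 4 dvd h + 3 * m + 1 then X i else 0 else 0) + (if i = Suc m then X i else 0))"
        by (intro sum.cong refl, subst Bmat_Sq2) (use that in auto)
      also have "\<dots> = (if 4 dvd h + 3 * m \<or> 4 dvd h + 3 * m + 1 then X m else 0) + X (Suc m)"
        using that by (simp add: sum.distrib)
      finally show ?thesis using col[OF that(4)] that(3) by simp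
    qed
    show "X i = 0"
    proof (cases "odd (h + i) \<and> 2 * i < h")
      case True
      then show ?thesis using sq1[of i] i by (simp add: I_def)
    next
      case False
      show ?thesis
      proof (cases "odd i")
        case odd: True
        define l where "l = i - 1"
        have l: "i = Suc l" "even l" using odd by (auto simp: l_def elim: oddE)
        have le: "2 * l + 2 \<le> h" using i l by (auto simp: I_def)
        have "pivot h i = (h + 1) div 2 + l"
          by (simp only: pivot_def if_not_P[OF False] if_P[OF odd] l_def)
        moreover have "\<not> (4 dvd h + 3 * l \<or> 4 dvd h + 3 * l + 1) \<or> X l = 0"
        proof (cases "odd h")
          case True
          then show ?thesis using sq1[of l] le l by simp
        next
          case even: False
          have "i \<le> h div 2" using i by (auto simp: I_def)
          then have h: "h = 2 * i" using False even odd by auto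
          then have "\<not> 4 dvd i + 1" using i unfolding I_def h by (simp add: survivors_double)
          then have "\<not> (4 dvd h + 3 * l \<or> 4 dvd h + 3 * l + 1)"
            using l(2) unfolding h l(1) by presburger
          then show ?thesis ..
        qed
        ultimately show ?thesis using sq2[of l i] le l i by (auto split: if_splits)
      next
        case even: False
        have I: "i \<notin> survivors h" "i \<le> h div 2" using i by (auto simp: I_def)
        have "2 * i < h" if "odd h" using that I(2) by (auto elim!: oddE)
        then have "even h" using even False by auto
        then obtain g where h: "h = 2 * g" by blast
        have g: "i < g" "4 dvd 2 * g + i"
          using I even unfolding h survivors_double by (simp_all, presburger+)
        then have *: "even h" "2 * i + 2 \<le> h" "4 dvd h + 3 * i"
          using even unfolding h by presburger+
        \<comment> \<open>This is the identification of the two highest basis vectors: the top row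
          has been deleted, so \<open>X\<close> vanishes there by its support.\<close>
        have top: "Suc i \<in> survivors h" if "2 * Suc i = h"
        proof -
          have "g = Suc i" using that h by simp
          moreover from this have "4 dvd g + 1" using g(2) even by presburger
          ultimately show ?thesis using survivors_double[of g g] h by simp
        qed
        have "X (Suc i) = 0"
        proof (cases "2 * Suc i = h")
          case True
          then show ?thesis using top X by (simp add: I_def)
        next
          case False
          then show ?thesis using sq1[of "Suc i"] * even by simp
        qed
        moreover have "pivot h i = (h + 1) div 2 + i" using False even unfolding pivot_def by simp
        ultimately show ?thesis using sq2[of i i] * even i by simp
      qed
    qed
  qed
  then show ?thesis by simp
qed

theorem theorem6p1:
  fixes h :: nat
  shows "(odd h \<longrightarrow>
            vec_space.rank (dim_row (Bmat h)) (Bmat h) = dim_row (Bmat h) \<and>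
            carrier (Qmod h) = {\<zero>\<^bsub>Qmod h\<^esub>})
       \<and> (even h \<longrightarrow>
            inj_on (Q_class h) (Gset h) \<and>
            vectorspace.basis class_ring (Qmod h) (Q_class h ` Gset h))
       \<and> vectorspace.dim class_ring (Qmod h) = (if odd h then 0 else (h + 2) div 8 + 1)
       \<and> (\<exists>I J. I \<subseteq> {..<dim_row (Bmat h)} \<and> J \<subseteq> {..<dim_col (Bmat h)} \<and>
            card I = card J \<and>
            card I + vectorspace.dim class_ring (Qmod h) = vectorspace.dim class_ring (MO2_deg h) \<and>
            det (submatrix (Bmat h) I J) = 1)"
proof (intro conjI impI)
  let ?I = "{..h div 2} - survivors h"
  interpret Q: vectorspace class_ring "Qmod h" by (rule Qmod_vectorspace)
  {
    assume "odd h"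
    then have empty: "survivors h = {}" by (rule survivors_odd)
    \<comment> \<open>For odd \<open>h\<close> no row is deleted, so the minor has full row
      size.\<close>
    then have "?I = {..<dim_row (Bmat h)}" by (simp add: dim_Bmat lessThan_Suc_atMost)
    then show "vec_space.rank (dim_row (Bmat h)) (Bmat h) = dim_row (Bmat h)"
      using Bmat_minor[of h] rank_eq_dim_row[of "Bmat h" "pivot h ` ?I"] by simp
    have "Q.basis {}" using Qmod_basis(2)[of h] empty by simp
    then show "carrier (Qmod h) = {\<zero>\<^bsub>Qmod h\<^esub>}"
      using Q.span_empty by (simp add: Q.basis_def)
  }
  {
    assume "even h"
    then have G: "Gset h = eMO h ` survivors h" by (rule Gset_eq)
    show "inj_on (Q_class h) (Gset h)"
      unfolding G using Qmod_basis(1) by (auto simp: inj_on_def)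
    show "Q.basis (Q_class h ` Gset h)"
      unfolding G image_image by (rule Qmod_basis(2))
  }
  show dim: "Q.dim = (if odd h then 0 else (h + 2) div 8 + 1)"
    by (simp only: Qmod_basis(3) card_survivors)
  have "survivors h \<subseteq> {..h div 2}" by (auto simp: survivors_le)
  then have card: "card ?I + card (survivors h) = h div 2 + 1"
    using card_Diff_subset[of "survivors h" "{..h div 2}"] card_mono[of "{..h div 2}" "survivors h"] by simp
  show "\<exists>I J. I \<subseteq> {..<dim_row (Bmat h)} \<and> J \<subseteq> {..<dim_col (Bmat h)} \<and> card I = card J \<and>
      card I + Q.dim = vectorspace.dim class_ring (MO2_deg h) \<and> det (submatrix (Bmat h) I J) = 1"
  proof (intro exI conjI)
    show "?I \<subseteq> {..<dim_row (Bmat h)}" by (auto simp: dim_Bmat)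
    show "pivot h ` ?I \<subseteq> {..<dim_col (Bmat h)}"
      using pivot_less unfolding dim_Bmat by blast
    show "card ?I = card (pivot h ` ?I)"
      by (rule card_image[OF inj_on_pivot, symmetric])
    show "card ?I + Q.dim = vectorspace.dim class_ring (MO2_deg h)"
      using card by (simp only: Qmod_basis(3) dim_MO2_deg)
  qed (rule Bmat_minor)
qed

end
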